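(* Let $R$ be a commutative ring with $1\ne0$, $n\ge1$, $f\in R[X_1,\dots,X_n]$, and let $s$ be an $n$-dimensional sequence over $R$ indexed by $-\mathbb{N}^n$. Then $(f\,\Gamma(s))|(-\infty,\mathbf 0]=\Gamma(f\circ s)$.
   Context: $\mathbb{N}=\{0,1,2,\dots\}$; vectors are ordered componentwise; $X^a=X_1^{a_1}\cdots X_n^{a_n}$. A sequence is $s:-\mathbb{N}^n\to R$, $a\mapsto s_a$; $R[X_1,\dots,X_n]$ acts by right shifting, $(f\circ s)_b=\sum_af_as_{b-a}$ for $f=\sum_af_aX^a$, $b\le\mathbf 0$. $\Gamma(s)=\sum_{a\le\mathbf 0}s_aX^a\in R[[X_1^{-1},\dots,X_n^{-1}]]$. The product $f\,\Gamma(s)$ is taken in $L_n=R((X_1^{-1},\dots,X_n^{-1}))$, the ring of formal sums $G=\sum_{a\in\mathbb{Z}^n}G_aX^a$ whose support lies in $\{a:a\le d\}$ for some $d\in\mathbb{Z}^n$. For $A\subseteq\mathbb{Z}^n$, $G|A=\sum_{a\in A}G_aX^a$; $(-\infty,\mathbf 0]=\{c\in\mathbb{Z}^n:c\le\mathbf 0\}$. *)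

theory Defs
  imports "HOL-Analysis.Analysis" "HOL-Library.Poly_Mapping"
begin

text \<open>
  Multi-indices are vectors over a finite index type \<open>'n\<close> (so \<open>n = CARD('n) \<ge> 1\<close>), ordered
  componentwise by the library order on \<open>vec\<close>. A polynomial in \<open>n\<close> variables over \<open>R\<close> is a finitely
  supported map from exponents in \<open>nat ^ 'n\<close> to \<open>R\<close>.
\<close>

type_synonym ('a, 'n) mpoly = "(nat ^ 'n) \<Rightarrow>\<^sub>0 'a"

definition exponent :: "nat ^ 'n \<Rightarrow> int ^ 'n" where
  "exponent a = (\<chi> i. int (a $ i))"

lemma finite_Icc_int_vec: "finite {l..u :: int ^ 'n}"
proof -
  have "{l..u} \<subseteq> vec_lambda ` (\<Pi>\<^sub>E i\<in>UNIV. {l $ i..u $ i})"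
  proof
    fix x assume "x \<in> {l..u}"
    then have "vec_nth x \<in> (\<Pi>\<^sub>E i\<in>UNIV. {l $ i..u $ i})"
      by (auto simp: less_eq_vec_def)
    then show "x \<in> vec_lambda ` (\<Pi>\<^sub>E i\<in>UNIV. {l $ i..u $ i})"
      by (metis image_eqI vec_nth_inverse)
  qed
  then show ?thesis
    by (rule finite_subset) (intro finite_imageI finite_PiE, auto)
qed


section \<open>The ring \<open>R((X\<^sub>1\<^sup>-\<^sup>1, \<dots>, X\<^sub>n\<^sup>-\<^sup>1))\<close>\<close>

typedef (overloaded) ('a, 'n::finite) laurent =
  "{G :: int ^ 'n \<Rightarrow> 'a::zero. \<exists>d. {a. G a \<noteq> 0} \<subseteq> {..d}}"
  morphisms laurent_coeff Abs_laurent
  by (rule exI[of _ "\<lambda>_. 0"]) auto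

setup_lifting type_definition_laurent

lemma laurent_eqI:
  fixes F G :: "('a::zero, 'n::finite) laurent"
  assumes "\<And>a. laurent_coeff F a = laurent_coeff G a"
  shows "F = G"
  using assms laurent_coeff_inject[of F G] by (simp add: fun_eq_iff)

lemma coeff_bounded:
  fixes G :: "('a::zero, 'n::finite) laurent"
  obtains d where "\<And>a. laurent_coeff G a \<noteq> 0 \<Longrightarrow> a \<le> d"
  using laurent_coeff[of G] by auto

lemma vec_le_add_mono: "a \<le> (c :: int ^ 'n) \<Longrightarrow> b \<le> d \<Longrightarrow> a + b \<le> c + d"
  by (simp add: less_eq_vec_def add_mono)

lemma vec_le_diff: "a + b \<le> c \<longleftrightarrow> a \<le> c - (b :: int ^ 'n)"
  by (simp add: less_eq_vec_def le_diff_eq)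

lemma vec_upper_bound: "\<exists>u. d \<le> u \<and> e \<le> (u :: int ^ 'n)"
  by (rule exI[of _ "\<chi> i. max (d $ i) (e $ i)"]) (simp add: less_eq_vec_def)

lemma convolution_bounded:
  fixes F G :: "int ^ 'n \<Rightarrow> 'a::comm_ring_1"
  assumes F: "\<And>a. F a \<noteq> 0 \<Longrightarrow> a \<le> d" and G: "\<And>a. G a \<noteq> 0 \<Longrightarrow> a \<le> e"
    and c: "Sum_any (\<lambda>a. F a * G (c - a)) \<noteq> 0"
  shows "c \<le> d + e"
proof -
  have "\<exists>a. F a * G (c - a) \<noteq> 0"
    using c by (rule contrapos_np) simp
  then obtain a where "F a \<noteq> 0" "G (c - a) \<noteq> 0"
    by (metis mult_zero_left mult_zero_right)
  then have "a + (c - a) \<le> d + e"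
    by (intro vec_le_add_mono F G)
  then show ?thesis by simp
qed

instantiation laurent :: (comm_ring_1, finite) comm_ring_1
begin

lift_definition zero_laurent :: "('a, 'b) laurent" is "\<lambda>_. 0"
  by auto

lift_definition one_laurent :: "('a, 'b) laurent" is "\<lambda>a. if a = 0 then 1 else 0"
  by (rule exI[of _ 0]) auto

lift_definition plus_laurent :: "('a, 'b) laurent \<Rightarrow> ('a, 'b) laurent \<Rightarrow> ('a, 'b) laurent"
  is "\<lambda>F G a. F a + G a"
proof -
  fix F G :: "int ^ 'b \<Rightarrow> 'a"
  assume "\<exists>d. {a. F a \<noteq> 0} \<subseteq> {..d}" "\<exists>d. {a. G a \<noteq> 0} \<subseteq> {..d}"
  then obtain d e where "\<And>a. F a \<noteq> 0 \<Longrightarrow> a \<le> d" "\<And>a. G a \<noteq> 0 \<Longrightarrow> a \<le> e"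
    by auto
  moreover obtain u where "d \<le> u" "e \<le> u"
    using vec_upper_bound by blast
  ultimately have "F a = 0 \<and> G a = 0" if "\<not> a \<le> u" for a
    using that by (meson order_trans)
  then have "{a. F a + G a \<noteq> 0} \<subseteq> {..u}" by fastforce
  then show "\<exists>d. {a. F a + G a \<noteq> 0} \<subseteq> {..d}" ..
qed

lift_definition uminus_laurent :: "('a, 'b) laurent \<Rightarrow> ('a, 'b) laurent"
  is "\<lambda>F a. - F a"
  by simp

definition minus_laurent :: "('a, 'b) laurent \<Rightarrow> ('a, 'b) laurent \<Rightarrow> ('a, 'b) laurent"
  where "minus_laurent F G = F + - G"

text \<open>The sum below has finite support because the supports of both factors are bounded above.\<close>

lift_definition times_laurent :: "('a, 'b) laurent \<Rightarrow> ('a, 'b) laurent \<Rightarrow> ('a, 'b) laurent"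
  is "\<lambda>F G c. Sum_any (\<lambda>a. F a * G (c - a))"
proof -
  fix F G :: "int ^ 'b \<Rightarrow> 'a"
  assume "\<exists>d. {a. F a \<noteq> 0} \<subseteq> {..d}" "\<exists>d. {a. G a \<noteq> 0} \<subseteq> {..d}"
  then obtain d e where d: "\<And>a. F a \<noteq> 0 \<Longrightarrow> a \<le> d" and e: "\<And>a. G a \<noteq> 0 \<Longrightarrow> a \<le> e"
    by auto
  then have "\<And>c. Sum_any (\<lambda>a. F a * G (c - a)) \<noteq> 0 \<Longrightarrow> c \<le> d + e"
    by (rule convolution_bounded)
  then show "\<exists>d. {c. Sum_any (\<lambda>a. F a * G (c - a)) \<noteq> 0} \<subseteq> {..d}"
    by auto
qed

lemma coeff_times_bounded:
  fixes F G :: "('a, 'b) laurent"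
  assumes "\<And>a. laurent_coeff F a \<noteq> 0 \<Longrightarrow> a \<le> d" "\<And>a. laurent_coeff G a \<noteq> 0 \<Longrightarrow> a \<le> e"
    "laurent_coeff (F * G) c \<noteq> 0"
  shows "c \<le> d + e"
  using convolution_bounded[OF assms(1,2)] assms(3) by (simp add: times_laurent.rep_eq)

lemma coeff_times_eq_sum:
  fixes F G :: "('a, 'b) laurent"
  assumes "\<And>a. laurent_coeff F a \<noteq> 0 \<Longrightarrow> a \<le> d" "\<And>a. laurent_coeff G a \<noteq> 0 \<Longrightarrow> a \<le> e" "l + e \<le> c"
  shows "laurent_coeff (F * G) c = (\<Sum>a\<in>{l..d}. laurent_coeff F a * laurent_coeff G (c - a))"
proof -
  have "{a. laurent_coeff F a * laurent_coeff G (c - a) \<noteq> 0} \<subseteq> {l..d}"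
  proof
    fix a assume "a \<in> {a. laurent_coeff F a * laurent_coeff G (c - a) \<noteq> 0}"
    then have "a \<le> d" "c - a \<le> e"
      by (auto intro!: assms(1,2))
    moreover have "l \<le> a"
      unfolding less_eq_vec_def
    proof
      fix i
      have "c $ i - a $ i \<le> e $ i" "l $ i + e $ i \<le> c $ i"
        using \<open>c - a \<le> e\<close> assms(3) by (simp_all add: less_eq_vec_def)
      then show "l $ i \<le> a $ i" by linarith
    qed
    ultimately show "a \<in> {l..d}" by simp
  qed
  then show ?thesis
    by (simp add: times_laurent.rep_eq Sum_any.expand_superset[OF finite_Icc_int_vec])
qed

instance
proof
  fix F G H :: "('a, 'b) laurent"
  obtain d where d: "\<And>a. laurent_coeff F a \<noteq> 0 \<Longrightarrow> a \<le> d" using coeff_bounded[of F] by blast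
  obtain e where e: "\<And>a. laurent_coeff G a \<noteq> 0 \<Longrightarrow> a \<le> e" using coeff_bounded[of G] by blast
  obtain g where g: "\<And>a. laurent_coeff H a \<noteq> 0 \<Longrightarrow> a \<le> g" using coeff_bounded[of H] by blast
  show "F + G + H = F + (G + H)" "F + G = G + F" "0 + F = F" "- F + F = 0" "F - G = F + - G"
    by (auto intro!: laurent_eqI simp: plus_laurent.rep_eq zero_laurent.rep_eq
        uminus_laurent.rep_eq minus_laurent_def algebra_simps)
  show "(0 :: ('a, 'b) laurent) \<noteq> 1"
    by (metis one_laurent.rep_eq zero_laurent.rep_eq zero_neq_one)
  show "F * G = G * F"
  proof (rule laurent_eqI)
    fix c
    have "Sum_any (\<lambda>a. laurent_coeff F a * laurent_coeff G (c - a)) = Sum_any (\<lambda>a. laurent_coeff G a * laurent_coeff F (c - a))"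
    proof (rule Sum_any.reindex_cong[where l = "\<lambda>a. c - a"])
      show "bij (\<lambda>a. c - a)"
        by (rule involuntory_imp_bij) simp
    qed (auto simp: fun_eq_iff mult.commute)
    then show "laurent_coeff (F * G) c = laurent_coeff (G * F) c"
      by (simp add: times_laurent.rep_eq)
  qed
  show "1 * F = F"
  proof (rule laurent_eqI)
    fix c
    have "Sum_any (\<lambda>a. (if a = 0 then 1 else 0) * laurent_coeff F (c - a))
        = (\<Sum>a\<in>{0}. (if a = 0 then 1 else 0) * laurent_coeff F (c - a))"
      by (rule Sum_any.expand_superset) auto
    then show "laurent_coeff (1 * F) c = laurent_coeff F c"
      by (simp add: times_laurent.rep_eq one_laurent.rep_eq)
  qed
  show "(F + G) * H = F * H + G * H"
  proof (rule laurent_eqI)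
    fix c
    obtain u where u: "d \<le> u" "e \<le> u" using vec_upper_bound by blast
    have Fu: "\<And>a. laurent_coeff F a \<noteq> 0 \<Longrightarrow> a \<le> u"
      using d u(1) by (rule order_trans)
    have Gu: "\<And>a. laurent_coeff G a \<noteq> 0 \<Longrightarrow> a \<le> u"
      using e u(2) by (rule order_trans)
    have FGu: "\<And>a. laurent_coeff (F + G) a \<noteq> 0 \<Longrightarrow> a \<le> u"
      using Fu Gu by (force simp: plus_laurent.rep_eq)
    have c: "(c - g) + g \<le> c" by simp
    have "laurent_coeff ((F + G) * H) c
        = (\<Sum>a\<in>{c - g..u}. laurent_coeff (F + G) a * laurent_coeff H (c - a))"
      by (rule coeff_times_eq_sum[OF _ _ c]) (fact FGu, fact g)
    moreover have "laurent_coeff (F * H) c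
        = (\<Sum>a\<in>{c - g..u}. laurent_coeff F a * laurent_coeff H (c - a))"
      by (rule coeff_times_eq_sum[OF _ _ c]) (fact Fu, fact g)
    moreover have "laurent_coeff (G * H) c
        = (\<Sum>a\<in>{c - g..u}. laurent_coeff G a * laurent_coeff H (c - a))"
      by (rule coeff_times_eq_sum[OF _ _ c]) (fact Gu, fact g)
    ultimately show "laurent_coeff ((F + G) * H) c = laurent_coeff (F * H + G * H) c"
      by (simp add: plus_laurent.rep_eq sum.distrib distrib_right)
  qed
  show "F * G * H = F * (G * H)"
  proof (rule laurent_eqI)
    fix c
    have FG: "\<And>a. laurent_coeff (F * G) a \<noteq> 0 \<Longrightarrow> a \<le> d + e"
      using coeff_times_bounded[of F d G e] d e by blast
    have GH: "\<And>a. laurent_coeff (G * H) a \<noteq> 0 \<Longrightarrow> a \<le> e + g"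
      using coeff_times_bounded[of G e H g] e g by blast
    define B where "B = {c - g - e..d}"
    define A where "A = {c - g..d + e}"
    have inner: "laurent_coeff (F * G) a = (\<Sum>b\<in>B. laurent_coeff F b * laurent_coeff G (a - b))" if "a \<in> A" for a
      unfolding B_def using that
      by (intro coeff_times_eq_sum[OF d e]) (auto simp: A_def)
    have "laurent_coeff (F * G * H) c = (\<Sum>a\<in>A. laurent_coeff (F * G) a * laurent_coeff H (c - a))"
      unfolding A_def by (rule coeff_times_eq_sum[OF FG g]) auto
    also have "\<dots> = (\<Sum>a\<in>A. \<Sum>b\<in>B. laurent_coeff F b * laurent_coeff G (a - b) * laurent_coeff H (c - a))"
      by (simp add: inner sum_distrib_right)
    also have "\<dots> = (\<Sum>b\<in>B. \<Sum>a\<in>A. laurent_coeff F b * laurent_coeff G (a - b) * laurent_coeff H (c - a))"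
      by (rule sum.swap)
    also have "\<dots> = (\<Sum>b\<in>B. laurent_coeff F b * laurent_coeff (G * H) (c - b))"
    proof (rule sum.cong[OF refl])
      fix b assume "b \<in> B"
      then have b: "b \<le> d" by (simp add: B_def)
      have "laurent_coeff (G * H) (c - b) = (\<Sum>a\<in>{c - g - b..d + e - b}. laurent_coeff G a * laurent_coeff H (c - b - a))"
      proof (rule coeff_times_eq_sum[OF _ g])
        fix a assume "laurent_coeff G a \<noteq> 0"
        then have "a \<le> e" by (rule e)
        then show "a \<le> d + e - b"
          using b vec_le_add_mono[of a e b d] by (simp add: vec_le_diff[symmetric] add.commute)
      qed auto
      also have "\<dots> = (\<Sum>a\<in>A. laurent_coeff G (a - b) * laurent_coeff H (c - a))"
        by (rule sum.reindex_bij_witness[of _ "\<lambda>a. a - b" "\<lambda>a. a + b"])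
          (auto simp: A_def less_eq_vec_def algebra_simps)
      finally show "(\<Sum>a\<in>A. laurent_coeff F b * laurent_coeff G (a - b) * laurent_coeff H (c - a))
          = laurent_coeff F b * laurent_coeff (G * H) (c - b)"
        by (simp add: sum_distrib_left mult.assoc)
    qed
    also have "\<dots> = laurent_coeff (F * (G * H)) c"
      unfolding B_def by (rule coeff_times_eq_sum[OF d GH, symmetric]) (auto simp: algebra_simps)
    finally show "laurent_coeff (F * G * H) c = laurent_coeff (F * (G * H)) c" .
  qed
qed

end

lift_definition laurent_restrict :: "('a::zero, 'n::finite) laurent \<Rightarrow> (int ^ 'n) set \<Rightarrow> ('a, 'n) laurent"
  is "\<lambda>G A a. if a \<in> A then G a else 0"
  by (auto simp: subset_iff)

text \<open>The inclusion of \<open>R[X\<^sub>1, \<dots>, X\<^sub>n]\<close>, extending coefficients by zero outside \<open>\<nat>\<^sup>n\<close>.\<close>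

lift_definition laurent_of_mpoly :: "('a::zero, 'n::finite) mpoly \<Rightarrow> ('a, 'n) laurent"
  is "\<lambda>f a. if 0 \<le> a then Poly_Mapping.lookup f (\<chi> i. nat (a $ i)) else 0"
proof -
  fix f :: "('a, 'n) mpoly"
  have "a $ i \<le> int (\<Sum>k\<in>Poly_Mapping.keys f. k $ i)"
    if "0 \<le> a" "Poly_Mapping.lookup f (\<chi> i. nat (a $ i)) \<noteq> 0" for a i
  proof -
    have "(\<chi> i. nat (a $ i)) \<in> Poly_Mapping.keys f"
      using that(2) by (simp add: in_keys_iff)
    then have "(\<chi> i. nat (a $ i)) $ i \<le> (\<Sum>k\<in>Poly_Mapping.keys f. k $ i)"
      by (intro member_le_sum) auto
    then have "nat (a $ i) \<le> (\<Sum>k\<in>Poly_Mapping.keys f. k $ i)"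
      by simp
    then show ?thesis by linarith
  qed
  then show "\<exists>d. {a. (if 0 \<le> a then Poly_Mapping.lookup f (\<chi> i. nat (a $ i)) else 0) \<noteq> 0} \<subseteq> {..d}"
    by (intro exI[of _ "\<chi> i. int (\<Sum>k\<in>Poly_Mapping.keys f. k $ i)"])
      (auto simp: less_eq_vec_def simp del: of_nat_sum)
qed


section \<open>Sequences\<close>

text \<open>
  A sequence \<open>s : -\<nat>\<^sup>n \<rightarrow> R\<close> is a function on \<open>int ^ 'n\<close> that is \<open>undefined\<close> outside
  \<open>{..0} = -\<nat>\<^sup>n\<close>, so that these functions correspond exactly to the maps on \<open>-\<nat>\<^sup>n\<close>.
\<close>

definition sequences :: "(int ^ 'n \<Rightarrow> 'a) set" where
  "sequences = {..0} \<rightarrow>\<^sub>E UNIV"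

definition shift_action :: "('a::comm_ring_1, 'n) mpoly \<Rightarrow> (int ^ 'n \<Rightarrow> 'a) \<Rightarrow> (int ^ 'n \<Rightarrow> 'a)"
  (infixr "\<circ>\<^sub>s" 70)
  where "f \<circ>\<^sub>s s =
    (\<lambda>b\<in>{..0}. \<Sum>a\<in>Poly_Mapping.keys f. Poly_Mapping.lookup f a * s (b - exponent a))"

text \<open>
  \<open>\<Gamma> s\<close> lies in \<open>R[[X\<^sub>1\<^sup>-\<^sup>1, \<dots>, X\<^sub>n\<^sup>-\<^sup>1]]\<close>, the subring of series supported in \<open>{..0}\<close>; it is given
  here directly as an element of the Laurent series ring.
\<close>

lift_definition gen_series :: "(int ^ 'n::finite \<Rightarrow> 'a::zero) \<Rightarrow> ('a, 'n) laurent" ("\<Gamma>")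
  is "\<lambda>s a. if a \<le> 0 then s a else 0"
  by (auto intro!: exI[of _ 0])

end

theory Submission
  imports Defs
begin

text \<open>
  Multiplying a Laurent series by a polynomial is itself a shift: \<open>X\<^sup>a\<close> moves the coefficient at
  \<open>c - a\<close> to \<open>c\<close>, so the coefficient of \<open>f G\<close> at \<open>c\<close> is \<open>\<Sum>\<^sub>a f\<^sub>a G\<^bsub>c - a\<^esub>\<close>, for every \<open>c\<close>
  (\<open>coeff_laurent_of_mpoly_times\<close>). This is the formula that defines \<open>f \<circ> s\<close>, except that the
  latter makes sense only for \<open>c \<le> 0\<close>. For such \<open>c\<close> all indices \<open>c - a\<close> are \<open>\<le> 0\<close> because
  exponents of polynomials are nonnegative, so the coefficients of \<open>\<Gamma> s\<close> that occur are genuine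
  entries of \<open>s\<close>. The restriction to \<open>{..0}\<close> discards the other \<open>c\<close>, where \<open>f \<Gamma> s\<close> may well have
  nonzero coefficients.
\<close>

lemma exponent_nonneg: "0 \<le> exponent a"
  by (simp add: less_eq_vec_def exponent_def)

lemma nat_exponent: "(\<chi> i. nat (exponent a $ i)) = a"
  by (simp add: vec_eq_iff exponent_def)

lemma exponent_nat: "0 \<le> c \<Longrightarrow> exponent (\<chi> i. nat (c $ i)) = c"
  by (simp add: vec_eq_iff exponent_def less_eq_vec_def)

lemma inj_on_exponent: "inj_on exponent A"
  by (rule inj_on_inverseI[where g = "\<lambda>c. \<chi> i. nat (c $ i)"]) (simp only: nat_exponent)

lemma coeff_laurent_of_mpoly_exponent:
  "laurent_coeff (laurent_of_mpoly f) (exponent a) = Poly_Mapping.lookup f a"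
  by (simp add: laurent_of_mpoly.rep_eq exponent_nonneg nat_exponent)

lemma coeff_laurent_of_mpoly_eq_0:
  assumes "c \<notin> exponent ` Poly_Mapping.keys f"
  shows "laurent_coeff (laurent_of_mpoly f) c = 0"
proof (cases "0 \<le> c")
  case True
  with assms have "(\<chi> i. nat (c $ i)) \<notin> Poly_Mapping.keys f"
    by (metis exponent_nat image_eqI)
  then show ?thesis
    by (simp add: laurent_of_mpoly.rep_eq in_keys_iff)
qed (simp add: laurent_of_mpoly.rep_eq)

text \<open>
  One factor has finite support, so the convolution collapses to a sum over the exponents of
  \<open>f\<close>, whatever the other factor is.
\<close>

lemma coeff_laurent_of_mpoly_times:
  fixes f :: "('a::comm_ring_1, 'n::finite) mpoly"
  shows "laurent_coeff (laurent_of_mpoly f * G) c =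
    (\<Sum>a\<in>Poly_Mapping.keys f. Poly_Mapping.lookup f a * laurent_coeff G (c - exponent a))"
proof -
  have "{a. laurent_coeff (laurent_of_mpoly f) a * laurent_coeff G (c - a) \<noteq> 0}
      \<subseteq> exponent ` Poly_Mapping.keys f"
    by (auto intro: ccontr simp: coeff_laurent_of_mpoly_eq_0)
  then have "laurent_coeff (laurent_of_mpoly f * G) c =
      (\<Sum>a\<in>exponent ` Poly_Mapping.keys f.
        laurent_coeff (laurent_of_mpoly f) a * laurent_coeff G (c - a))"
    unfolding times_laurent.rep_eq by (intro Sum_any.expand_superset) auto
  then show ?thesis
    by (simp add: sum.reindex[OF inj_on_exponent] coeff_laurent_of_mpoly_exponent)
qed

theorem proposition2p6:
  fixes f :: "('a::comm_ring_1, 'n::finite) mpoly"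
    and s :: "int ^ 'n \<Rightarrow> 'a"
  assumes "s \<in> sequences"
  shows "laurent_restrict (laurent_of_mpoly f * \<Gamma> s) {..0} = \<Gamma> (f \<circ>\<^sub>s s)"
proof (rule laurent_eqI)
  fix c :: "int ^ 'n"
  have "c - exponent a \<le> 0" if "c \<le> 0" for a
    using order_trans[OF that exponent_nonneg[of a]] by (simp add: less_eq_vec_def)
  then show "laurent_coeff (laurent_restrict (laurent_of_mpoly f * \<Gamma> s) {..0}) c
      = laurent_coeff (\<Gamma> (f \<circ>\<^sub>s s)) c"
    by (simp add: laurent_restrict.rep_eq gen_series.rep_eq coeff_laurent_of_mpoly_times
        shift_action_def)
qed

end
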